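(* Let $n \ge 1$, let $A \in \mathbb{R}^{n\times n}$ and $B \in \mathbb{R}^{n \times 1}$ be such that the pair $(A,B)$ is controllable, and consider the single-input linear time-invariant system $\dot{x} = Ax + B(u+w)$ with $x \in \mathbb{R}^n$ and $u,w \in \mathbb{R}$. Let $P = [\, B \;\; AB \;\; \cdots \;\; A^{n-1}B \,]$ be its controllability matrix and let $e_1 := [\, 0 \;\; 0 \;\; \cdots \;\; 0 \;\; 1 \,] \in \mathbb{R}^{1\times n}$. Let $1 \le r \le n$ and let $\gamma(\lambda) = \lambda^{n-r} + \gamma_{n-r-1}\lambda^{n-r-1} + \cdots + \gamma_1 \lambda + \gamma_0$ be a monic polynomial of degree $n-r$ with real coefficients. If $$C = e_1 P^{-1} \gamma(A),$$ then the output $\sigma = Cx$ has relative degree $r$, and the roots of $\gamma(\lambda)$ (counted with multiplicity) are the eigenvalues of the sliding-mode dynamics in the intersection of the planes $\sigma = \dot{\sigma} = \cdots = \sigma^{(r-1)} = 0$, i.e. of the matrix $A_0$ of the zero dynamics $\dot{\eta} = A_0\eta$, $\eta \in \mathbb{R}^{n-r}$, associated with the output $\sigma$.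
   Context: Here $x$ is the state, $u$ the control and $w$ an unknown perturbation. For the system $\dot{x} = Ax + B(u+w)$ with scalar output $\sigma = Cx$, $C \in \mathbb{R}^{1\times n}$: Relative degree: $\sigma$ has relative degree $r$ if $CA^{i-1}B = 0$ for all $1 \le i < r$ and $CA^{r-1}B \ne 0$. Sliding-mode dynamics (zero dynamics): suppose $\sigma$ has relative degree $r$. Then $\sigma^{(i)} = CA^i x$ for $0 \le i \le r-1$. It is a known fact that there is a full-rank matrix $B^\perp \in \mathbb{R}^{(n-r)\times n}$ with $B^\perp B = 0$ such that the $n \times n$ matrix $T$ obtained by stacking the rows of $B^\perp$ on top of the rows $C, CA, \dots, CA^{r-1}$ is invertible. Set $\eta = B^\perp x \in \mathbb{R}^{n-r}$ and $\xi = (\xi_1,\dots,\xi_r)^\top = (Cx, CAx, \dots, CA^{r-1}x)^\top$. In these coordinates the system satisfies $\dot{\eta} = A_0 \eta + B_0 \xi$, where $A_0 \in \mathbb{R}^{(n-r)\times(n-r)}$ and $B_0 \in \mathbb{R}^{(n-r)\times r}$ are determined by $[\, A_0 \;\; B_0 \,] = B^\perp A T^{-1}$, together with $\dot{\xi}_i = \xi_{i+1}$ for $1 \le i \le r-1$, $\dot{\xi}_r = CA^r x + CA^{r-1}B(u+w)$ and $\sigma = \xi_1$. The sliding-mode dynamics in the intersection of the planes $\sigma = \dot\sigma = \cdots = \sigma^{(r-1)} = 0$ (i.e. $\xi = 0$), also called the zero dynamics, is $\dot{\eta} = A_0 \eta$. A different admissible choice of $B^\perp$ replaces $A_0$ by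 a similar matrix, so its eigenvalues are well defined. If $r = n$, then $\gamma = 1$, there is no $\eta$, and the sliding-mode dynamics is trivial (zero-dimensional). *)

theory Defs
  imports Complex_Main "Jordan_Normal_Form.Char_Poly" "Jordan_Normal_Form.DL_Rank"
    "Jordan_Normal_Form.Gauss_Jordan_Elimination"
begin

text \<open>Throughout, the system \<open>x' = A x + B (u + w)\<close>, \<open>\<sigma> = C x\<close> has an \<open>n \<times> n\<close> matrix \<open>A\<close>,
  an \<open>n \<times> 1\<close> matrix \<open>B\<close> and a \<open>1 \<times> n\<close> matrix \<open>C\<close>; \<open>n\<close> is read off as \<open>dim_row A\<close>.\<close>

definition trajectory ::
    "real mat \<Rightarrow> real mat \<Rightarrow> real \<Rightarrow> (real \<Rightarrow> real) \<Rightarrow> (real \<Rightarrow> real vec) \<Rightarrow> bool" where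
  "trajectory A B \<tau> u x \<longleftrightarrow>
     (\<forall>t\<in>{0..\<tau>}. x t \<in> carrier_vec (dim_row A) \<and>
        (\<forall>i<dim_row A. ((\<lambda>s. x s $ i) has_real_derivative
            (A *\<^sub>v x t + u t \<cdot>\<^sub>v col B 0) $ i) (at t within {0..\<tau>})))"

text \<open>Controllability in the sense of Kalman: the unperturbed system can be steered from any state
  to any other one in finite time. For linear systems, enlarging the class of inputs beyond the
  continuous ones, or prescribing the time \<open>\<tau> > 0\<close>, gives an equivalent notion.\<close>
definition controllable :: "real mat \<Rightarrow> real mat \<Rightarrow> bool" where
  "controllable A B \<longleftrightarrow>
     (\<forall>x0\<in>carrier_vec (dim_row A). \<forall>x1\<in>carrier_vec (dim_row A).
        \<exists>\<tau>>0. \<exists>u x. continuous_on {0..\<tau>} u \<and> trajectory A B \<tau> u x \<and> x 0 = x0 \<and> x \<tau> = x1)"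

definition controllability_matrix :: "'a::semiring_1 mat \<Rightarrow> 'a mat \<Rightarrow> 'a mat" where
  "controllability_matrix A B =
     mat (dim_row A) (dim_row A) (\<lambda>(i, j). (A ^\<^sub>m j * B) $$ (i, 0))"

text \<open>Only meaningful for invertible matrices: \<open>mat_inverse\<close> returns \<open>None\<close> otherwise.\<close>
definition inverse_mat :: "'a::field mat \<Rightarrow> 'a mat" where
  "inverse_mat M = the (mat_inverse M)"

definition poly_mat :: "'a::comm_semiring_1 poly \<Rightarrow> 'a mat \<Rightarrow> 'a mat" where
  "poly_mat p A =
     mat (dim_row A) (dim_row A) (\<lambda>(i, j). \<Sum>k\<le>degree p. coeff p k * (A ^\<^sub>m k) $$ (i, j))"

definition last_unit_row :: "nat \<Rightarrow> 'a::zero_neq_one mat" where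
  "last_unit_row n = mat 1 n (\<lambda>(i, j). if j = n - 1 then 1 else 0)"

definition relative_degree :: "real mat \<Rightarrow> real mat \<Rightarrow> real mat \<Rightarrow> nat \<Rightarrow> bool" where
  "relative_degree A B C r \<longleftrightarrow> 1 \<le> r \<and>
     (\<forall>i. 1 \<le> i \<and> i < r \<longrightarrow> C * A ^\<^sub>m (i - 1) * B = 0\<^sub>m 1 1) \<and>
     C * A ^\<^sub>m (r - 1) * B \<noteq> 0\<^sub>m 1 1"

definition output_derivative_rows :: "real mat \<Rightarrow> real mat \<Rightarrow> nat \<Rightarrow> real mat" where
  "output_derivative_rows A C r = mat r (dim_row A) (\<lambda>(i, j). (C * A ^\<^sub>m i) $$ (0, j))"

definition normal_form_transformation ::
    "real mat \<Rightarrow> real mat \<Rightarrow> nat \<Rightarrow> real mat \<Rightarrow> real mat" where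
  "normal_form_transformation A C r Bp = Bp @\<^sub>r output_derivative_rows A C r"

text \<open>\<open>Bp\<close> stands for \<open>B\<^sup>\<bottom>\<close>; \<open>vec_space.rank (n - r) Bp = n - r\<close> says that the
  \<open>(n - r) \<times> n\<close> matrix \<open>Bp\<close> has full rank.\<close>
definition admissible_annihilator ::
    "real mat \<Rightarrow> real mat \<Rightarrow> real mat \<Rightarrow> nat \<Rightarrow> real mat \<Rightarrow> bool" where
  "admissible_annihilator A B C r Bp \<longleftrightarrow>
     (let n = dim_row A in
        Bp \<in> carrier_mat (n - r) n \<and>
        vec_space.rank (n - r) Bp = n - r \<and>
        Bp * B = 0\<^sub>m (n - r) 1 \<and>
        invertible_mat (normal_form_transformation A C r Bp))"

text \<open>\<open>A0\<close> is a matrix of the zero dynamics \<open>\<eta>' = A0 \<eta>\<close>, for some admissible choice of \<open>B\<^sup>\<bottom>\<close>.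
  The block matrix with two empty lower blocks is \<open>[A0 B0]\<close>.\<close>
definition zero_dynamics_matrix ::
    "real mat \<Rightarrow> real mat \<Rightarrow> real mat \<Rightarrow> nat \<Rightarrow> real mat \<Rightarrow> bool" where
  "zero_dynamics_matrix A B C r A0 \<longleftrightarrow>
     (let n = dim_row A in
        A0 \<in> carrier_mat (n - r) (n - r) \<and>
        (\<exists>Bp B0. admissible_annihilator A B C r Bp \<and> B0 \<in> carrier_mat (n - r) r \<and>
           four_block_mat A0 B0 (0\<^sub>m 0 (n - r)) (0\<^sub>m 0 r) =
             Bp * A * inverse_mat (normal_form_transformation A C r Bp)))"

text \<open>The complex eigenvalues of a real matrix, with algebraic multiplicity.\<close>
definition eigenvalue_mset :: "real mat \<Rightarrow> complex multiset" where
  "eigenvalue_mset M = proots (char_poly (map_mat complex_of_real M))"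

end

theory Submission
  imports Defs
begin

text \<open>
Controllability makes the matrix \<open>P = [B, A B, \<dots>, A\<^sup>n\<^sup>-\<^sup>1 B]\<close> invertible
(\<open>controllable_imp_controllability_matrix_nonsingular\<close>): otherwise some nonzero linear functional of
the state would stay zero along every trajectory starting at the origin, whatever the input.

Let \<open>y\<close> be the output with row \<open>flat = e\<^sub>1 P\<^sup>-\<^sup>1\<close>. By definition of the inverse, \<open>flat A\<^sup>k B\<close> is \<open>0\<close> for
\<open>k < n - 1\<close> and \<open>1\<close> for \<open>k = n - 1\<close>. So the system is a chain of \<open>n\<close> integrators from the input to \<open>y\<close>,
up to state feedback, and \<open>y, y', \<dots>, y\<^sup>(\<^sup>n\<^sup>-\<^sup>1\<^sup>)\<close> are coordinates on the state space
(\<open>dflat_separates\<close>). The designed output \<open>C = flat \<gamma>(A)\<close> is \<open>\<sigma> = \<gamma>(d/dt) y\<close>.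

Since \<open>\<gamma>\<close> is monic of degree \<open>n - r\<close>, the input first reaches \<open>\<sigma>\<close> after \<open>r\<close> differentiations
(\<open>relative_degree_r\<close>), and \<open>y, \<dots>, y\<^sup>(\<^sup>n\<^sup>-\<^sup>r\<^sup>-\<^sup>1\<^sup>)\<close> together with \<open>\<sigma>, \<dots>, \<sigma>\<^sup>(\<^sup>r\<^sup>-\<^sup>1\<^sup>)\<close> are again
coordinates, by a unit triangular change (\<open>transformation_nonsingular\<close>). While \<open>\<sigma>\<close> is held at zero, the equation
\<open>\<gamma>(d/dt) y = 0\<close> says that the first group evolves by the companion matrix of \<open>\<gamma>\<close>
(\<open>dflat_rows_zero_dynamics\<close>), whose characteristic polynomial is \<open>\<gamma>\<close>
(\<open>char_poly_companion_mat\<close>). Any other annihilator of \<open>B\<close> yields a similar matrix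
(\<open>zero_dynamics_similar\<close>), hence the same eigenvalues with the same multiplicities.
\<close>

section \<open>Controllability and the controllability matrix\<close>

text \<open>Gronwall's argument: the energy \<open>g = \<Sum>j. f\<^sub>j\<^sup>2\<close> satisfies \<open>g' \<le> K g\<close>, so \<open>g e\<^sup>-\<^sup>K\<^sup>t\<close> is
  nonincreasing, and it starts at \<open>0\<close>.\<close>
lemma linear_ode_zero_unique:
  fixes f :: "nat \<Rightarrow> real \<Rightarrow> real" and M :: "nat \<Rightarrow> nat \<Rightarrow> real"
  assumes deriv: "\<And>j t. j < m \<Longrightarrow> t \<in> {0..\<tau>} \<Longrightarrow>
      (f j has_real_derivative (\<Sum>k<m. M j k * f k t)) (at t within {0..\<tau>})"
    and init: "\<And>j. j < m \<Longrightarrow> f j 0 = 0"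
    and t: "t \<in> {0..\<tau>}" and j: "j < m"
  shows "f j t = 0"
proof -
  define K where "K = 2 * (\<Sum>j<m. \<Sum>k<m. \<bar>M j k\<bar>)"
  define g where "g t = (\<Sum>j<m. (f j t)\<^sup>2)" for t
  define g' where "g' t = (\<Sum>j<m. 2 * f j t * (\<Sum>k<m. M j k * f k t))" for t
  have g_deriv: "(g has_real_derivative g' s) (at s within {0..\<tau>})" if "s \<in> {0..\<tau>}" for s
    unfolding g_def[abs_def] g'_def
    by (rule DERIV_sum) (auto intro!: derivative_eq_intros deriv that)
  have sq_le: "(f j s)\<^sup>2 \<le> g s" if "j < m" for j s
    unfolding g_def by (rule member_le_sum) (use that in auto)
  have g'_le: "g' s \<le> K * g s" for s
  proof -
    \<comment> \<open>The mixed products of the components are absorbed into \<open>g\<close> by \<open>2ab \<le> a\<^sup>2 + b\<^sup>2\<close>.\<close>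
    have "2 * f j s * (M j k * f k s) \<le> \<bar>M j k\<bar> * (2 * g s)" if "j < m" "k < m" for j k
    proof -
      have "2 * f j s * (M j k * f k s) \<le> \<bar>M j k\<bar> * (2 * \<bar>f j s\<bar> * \<bar>f k s\<bar>)"
        by (rule order_trans[OF abs_ge_self]) (simp add: abs_mult)
      also have "2 * \<bar>f j s\<bar> * \<bar>f k s\<bar> \<le> (f j s)\<^sup>2 + (f k s)\<^sup>2"
        using sum_squares_bound[of "\<bar>f j s\<bar>" "\<bar>f k s\<bar>"] by simp
      also have "\<dots> \<le> 2 * g s"
        using sq_le[OF that(1), of s] sq_le[OF that(2), of s] by simp
      finally show ?thesis by (simp add: mult_left_mono)
    qed
    then have "g' s \<le> (\<Sum>j<m. \<Sum>k<m. \<bar>M j k\<bar> * (2 * g s))"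
      unfolding g'_def sum_distrib_left by (intro sum_mono) auto
    also have "\<dots> = K * g s"
      by (simp add: K_def sum_distrib_right sum_distrib_left algebra_simps)
    finally show ?thesis .
  qed
  have "g t * exp (- K * t) \<le> g 0 * exp (- K * 0)"
  proof (rule DERIV_nonpos_imp_decreasing_open[where a = 0 and b = t
        and f = "\<lambda>s. g s * exp (- K * s)"])
    show "0 \<le> t" using t by simp
    show "continuous_on {0..t} (\<lambda>s. g s * exp (- K * s))"
    proof (intro continuous_intros)
      have "continuous_on {0..\<tau>} g"
        using g_deriv by (meson DERIV_continuous_on)
      then show "continuous_on {0..t} g"
        by (rule continuous_on_subset) (use t in auto)
    qed
    fix s assume s: "0 < s" "s < t"
    have "at s within {0..\<tau>} = at s"
      by (rule at_within_Icc_at) (use s t in auto)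
    with g_deriv[of s] s t have "DERIV g s :> g' s" by auto
    then have "DERIV (\<lambda>s. g s * exp (- K * s)) s :> (g' s - K * g s) * exp (- K * s)"
      by (auto intro!: derivative_eq_intros simp: algebra_simps)
    moreover have "(g' s - K * g s) * exp (- K * s) \<le> 0"
      using g'_le[of s] by (simp add: mult_nonpos_nonneg)
    ultimately show "\<exists>y. DERIV (\<lambda>s. g s * exp (- K * s)) s :> y \<and> y \<le> 0" by blast
  qed
  moreover have "g 0 = 0" by (simp add: g_def init)
  ultimately have "g t \<le> 0" by (simp add: mult_le_0_iff)
  with sq_le[OF j, of t] have "(f j t)\<^sup>2 \<le> 0" by linarith
  then show ?thesis by simp
qed

text \<open>Among the \<open>n + 1\<close> vectors \<open>s 0, \<dots>, s n\<close> of an \<open>n\<close>-dimensional space there is a nontrivial relation,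
  and its last nonzero coefficient sits at the vector \<open>s m\<close>. Applied to the iterates of a row under
  \<open>A\<close>, this replaces the Cayley-Hamilton theorem.\<close>
lemma linear_dependence_on_predecessors:
  fixes s :: "nat \<Rightarrow> 'a::field vec"
  assumes s: "\<And>j. s j \<in> carrier_vec n"
  obtains m a where "m \<le> n" "\<And>i. i < n \<Longrightarrow> s m $ i = (\<Sum>j<m. a j * s j $ i)"
proof -
  \<comment> \<open>Padding with a zero row makes the matrix of the \<open>n + 1\<close> columns square, hence singular.\<close>
  define D where "D = mat (Suc n) (Suc n) (\<lambda>(i, j). if i < n then s j $ i else 0)"
  have D: "D \<in> carrier_mat (Suc n) (Suc n)" by (simp add: D_def)
  have "det D = (\<Sum>j<Suc n. D $$ (n, j) * cofactor D n j)"
    by (rule laplace_expansion_row[OF D]) simp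
  also have "\<dots> = 0" by (rule sum.neutral) (auto simp: D_def)
  finally obtain c where c: "c \<in> carrier_vec (Suc n)" "c \<noteq> 0\<^sub>v (Suc n)" "D *\<^sub>v c = 0\<^sub>v (Suc n)"
    using det_0_iff_vec_prod_zero_field[OF D] by auto
  define m where "m = Max {j. j < Suc n \<and> c $ j \<noteq> 0}"
  have ne: "{j. j < Suc n \<and> c $ j \<noteq> 0} \<noteq> {}"
  proof
    assume "{j. j < Suc n \<and> c $ j \<noteq> 0} = {}"
    then have "c = 0\<^sub>v (Suc n)" using c(1) by (intro eq_vecI) auto
    with c(2) show False by contradiction
  qed
  have "m \<in> {j. j < Suc n \<and> c $ j \<noteq> 0}"
    unfolding m_def by (rule Max_in) (use ne in auto)
  then have m: "m < Suc n" "c $ m \<noteq> 0" by auto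
  have above: "c $ j = 0" if "m < j" "j < Suc n" for j
  proof (rule ccontr)
    assume "c $ j \<noteq> 0"
    with that have "j \<le> m" unfolding m_def by (intro Max_ge) auto
    with that show False by simp
  qed
  show thesis
  proof
    show "m \<le> n" using m by simp
    fix i assume i: "i < n"
    have "0 = (D *\<^sub>v c) $ i" using c(3) i by simp
    also have "\<dots> = (\<Sum>j<Suc n. s j $ i * c $ j)"
      using i c(1) by (auto simp: D_def scalar_prod_def atLeast0LessThan intro!: sum.cong)
    also have "\<dots> = (\<Sum>j<Suc m. s j $ i * c $ j)"
      by (rule sum.mono_neutral_right) (use m above in auto)
    finally have "s m $ i * c $ m = - (\<Sum>j<m. s j $ i * c $ j)"
      by (simp add: add_eq_0_iff)
    then have "s m $ i = - (\<Sum>j<m. s j $ i * c $ j) / c $ m"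
      using m(2) by (simp add: field_simps)
    also have "\<dots> = (\<Sum>j<m. (- c $ j / c $ m) * s j $ i)"
      by (simp add: sum_divide_distrib sum_negf[symmetric] mult.commute)
    finally show "s m $ i = (\<Sum>j<m. (- c $ j / c $ m) * s j $ i)" .
  qed
qed

text \<open>If the controllability matrix is singular, some row \<open>v \<noteq> 0\<close> has \<open>v A\<^sup>j B = 0\<close> for all \<open>j < n\<close>. The
  functions \<open>f\<^sub>j = v A\<^sup>j x\<close> then do not feel the input: \<open>f\<^sub>j' = f\<^sub>j\<^sub>+\<^sub>1\<close>. As some \<open>v A\<^sup>m\<close> with
  \<open>m \<le> n\<close> depends on its predecessors, \<open>f\<^sub>0, \<dots>, f\<^sub>m\<^sub>-\<^sub>1\<close> solve a closed homogeneous linear system, so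
  they vanish along any trajectory from the origin. Such a trajectory therefore never reaches the state \<open>v\<close>.\<close>
lemma controllable_imp_controllability_matrix_nonsingular:
  assumes A: "A \<in> carrier_mat n n" and B: "B \<in> carrier_mat n 1"
    and ctrl: "controllable A B"
  shows "det (controllability_matrix A B) \<noteq> 0"
proof
  assume "det (controllability_matrix A B) = 0"
  moreover have P: "controllability_matrix A B \<in> carrier_mat n n"
    using A by (simp add: controllability_matrix_def)
  ultimately obtain v where v: "v \<in> carrier_vec n" "v \<noteq> 0\<^sub>v n"
      "(controllability_matrix A B)\<^sup>T *\<^sub>v v = 0\<^sub>v n"
    using det_0_iff_vec_prod_zero_field[of "(controllability_matrix A B)\<^sup>T" n]
    by (auto simp: det_transpose)
  define s where "s j = (A ^\<^sub>m j)\<^sup>T *\<^sub>v v" for j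
  have s: "s j \<in> carrier_vec n" for j
    unfolding s_def by (rule mult_mat_vec_carrier[OF _ v(1)]) (use A in simp)
  have s_0: "s 0 = v" using A v by (simp add: s_def)
  have s_Suc: "s (Suc j) = A\<^sup>T *\<^sub>v s j" for j
  proof -
    have "(A ^\<^sub>m Suc j)\<^sup>T = A\<^sup>T * (A ^\<^sub>m j)\<^sup>T"
      using transpose_mult[OF pow_carrier_mat[OF A] A] by simp
    then show ?thesis
      unfolding s_def using A v by (simp add: assoc_mult_mat_vec[of _ n n _ n])
  qed
  have s_B: "s j \<bullet> col B 0 = 0" if j: "j < n" for j
  proof -
    have cb: "col B 0 \<in> carrier_vec n" using B by auto
    have "s j \<bullet> col B 0 = v \<bullet> ((A ^\<^sub>m j) *\<^sub>v col B 0)"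
      unfolding s_def using transpose_vec_mult_scalar[OF pow_carrier_mat[OF A] cb v(1)] .
    also have "(A ^\<^sub>m j) *\<^sub>v col B 0 = col (controllability_matrix A B) j"
      using A B j by (intro eq_vecI) (auto simp: controllability_matrix_def)
    also have "v \<bullet> \<dots> = ((controllability_matrix A B)\<^sup>T *\<^sub>v v) $ j"
      using P v(1) j comm_scalar_prod[OF v(1), of "col (controllability_matrix A B) j"] by auto
    also have "\<dots> = 0" using v(3) j by simp
    finally show ?thesis .
  qed
  obtain m a where m: "m \<le> n" and a: "\<And>i. i < n \<Longrightarrow> s m $ i = (\<Sum>j<m. a j * s j $ i)"
    using linear_dependence_on_predecessors[of s n] s by metis
  have "0 < m"
  proof (rule ccontr)
    assume "\<not> 0 < m"
    with a s_0 v(1) have "v = 0\<^sub>v n" by (intro eq_vecI) auto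
    with v(2) show False by contradiction
  qed
  from ctrl[unfolded controllable_def, rule_format, of "0\<^sub>v n" v] A v(1)
  obtain \<tau> u x where \<tau>: "\<tau> > 0" and traj: "trajectory A B \<tau> u x"
    and x0: "x 0 = 0\<^sub>v n" and x1: "x \<tau> = v" by auto
  define f where "f j t = (\<Sum>i<n. s j $ i * x t $ i)" for j t
  have x: "x t \<in> carrier_vec n" if "t \<in> {0..\<tau>}" for t
    using traj that A by (auto simp: trajectory_def)
  have f_scalar: "f j t = s j \<bullet> x t" if "t \<in> {0..\<tau>}" for j t
    using x[OF that] by (simp add: f_def scalar_prod_def atLeast0LessThan)
  have f_deriv: "(f j has_real_derivative f (Suc j) t) (at t within {0..\<tau>})"
    if j: "j < n" and t: "t \<in> {0..\<tau>}" for j t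
  proof -
    let ?y = "A *\<^sub>v x t + u t \<cdot>\<^sub>v col B 0"
    have "(f j has_real_derivative (\<Sum>i<n. s j $ i * ?y $ i)) (at t within {0..\<tau>})"
      unfolding f_def[abs_def]
      by (intro DERIV_sum DERIV_cmult) (use traj t A in \<open>auto simp: trajectory_def\<close>)
    also have "(\<Sum>i<n. s j $ i * ?y $ i) = s j \<bullet> ?y"
      using A B x[OF t] by (auto simp: scalar_prod_def atLeast0LessThan)
    also have "s j \<bullet> ?y = s j \<bullet> (A *\<^sub>v x t) + s j \<bullet> (u t \<cdot>\<^sub>v col B 0)"
      by (rule scalar_prod_add_distrib[OF s]) (use A B x[OF t] in auto)
    also have "s j \<bullet> (u t \<cdot>\<^sub>v col B 0) = u t * (s j \<bullet> col B 0)"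
      using s B by (metis carrier_matD(1) col_dim scalar_prod_smult_right carrier_vecD)
    also have "s j \<bullet> (A *\<^sub>v x t) = s (Suc j) \<bullet> x t"
      unfolding s_Suc using transpose_vec_mult_scalar[OF A x[OF t] s] by simp
    finally show ?thesis using s_B[OF j] f_scalar[OF t] by simp
  qed
  have "f 0 \<tau> = 0"
  proof (rule linear_ode_zero_unique[where f = f and m = m and \<tau> = \<tau> and j = 0 and t = \<tau>
        and M = "\<lambda>j k. if Suc j = m then a k else if k = Suc j then 1 else 0"])
    fix j t assume j: "j < m" and t: "t \<in> {0..\<tau>}"
    have "f (Suc j) t = (\<Sum>k<m. (if Suc j = m then a k else if k = Suc j then 1 else 0) * f k t)"
    proof (cases "Suc j = m")
      case True
      have "f m t = (\<Sum>i<n. \<Sum>k<m. a k * (s k $ i * x t $ i))"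
        unfolding f_def by (simp add: a sum_distrib_right mult.assoc)
      also have "\<dots> = (\<Sum>k<m. a k * f k t)"
        unfolding f_def sum_distrib_left by (rule sum.swap)
      finally show ?thesis using True by simp
    next
      case False
      with j show ?thesis by (simp add: if_distrib[of "\<lambda>c. c * _"] cong: if_cong)
    qed
    with f_deriv[of j t] j m t
    show "(f j has_real_derivative
        (\<Sum>k<m. (if Suc j = m then a k else if k = Suc j then 1 else 0) * f k t))
        (at t within {0..\<tau>})" by simp
  next
    show "f j 0 = 0" for j by (simp add: f_def x0)
  qed (use \<tau> \<open>0 < m\<close> in auto)
  then have "v \<bullet> v = 0" using f_scalar[of \<tau> 0] \<tau> x1 s_0 by simp
  then have "(\<Sum>i<n. (v $ i)\<^sup>2) = 0"
    using v(1) by (simp add: scalar_prod_def atLeast0LessThan power2_eq_square)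
  then have "v = 0\<^sub>v n"
    using v(1) by (intro eq_vecI) (auto simp: sum_nonneg_eq_0_iff)
  with v(2) show False by contradiction
qed

section \<open>Companion matrices\<close>

text \<open>The lower companion matrix, with ones above the diagonal and the negated coefficients in the last
  row: for monic \<open>p\<close>, the system matrix of the scalar equation \<open>p(d/dt) y = 0\<close> in the state
  \<open>(y, y', \<dots>)\<close>.\<close>
definition companion_mat :: "'a::comm_ring_1 poly \<Rightarrow> 'a mat" where
  "companion_mat p = mat (degree p) (degree p)
     (\<lambda>(i, j). if Suc i = degree p then - coeff p j else if j = Suc i then 1 else 0)"

lemma companion_mat_carrier [simp]: "companion_mat p \<in> carrier_mat (degree p) (degree p)"
  by (simp add: companion_mat_def)

lemma poly_eq_sum_X_powers:
  "p = (\<Sum>k\<le>degree p. Polynomial.smult (coeff p k) ([:0, 1:] ^ k))"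
  using poly_as_sum_of_monoms[of p] by (simp add: monom_altdef)

text \<open>Multiplying \<open>x I - K\<close>, for the companion matrix \<open>K\<close>, from the right by the unit lower triangular
  matrix of the powers \<open>x\<^sup>i\<^sup>-\<^sup>j\<close> clears everything in the upper rows except the entries \<open>-1\<close> above the
  diagonal, and by Horner's scheme the bottom left corner becomes \<open>p\<close>. Expansion along the first
  column leaves only \<open>p\<close>, whose cofactor is \<open>(-1)\<^sup>l (-1)\<^sup>l = 1\<close> with
  \<open>l = degree p - 1\<close>.\<close>
lemma char_poly_companion_mat:
  fixes p :: "'a::comm_ring_1 poly"
  assumes monic: "lead_coeff p = 1"
  shows "char_poly (companion_mat p) = p"
proof (cases "degree p")
  case 0
  have "p = 1" using monic 0 monic_degree_0[of p] by simp
  moreover have "char_poly (companion_mat p) = 1"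
    using 0 by (simp add: char_poly_def companion_mat_def char_poly_matrix_def det_def)
  ultimately show ?thesis by simp
next
  case (Suc l)
  let ?m = "Suc l" and ?x = "[:0, 1:] :: 'a poly"
  define L where "L = mat ?m ?m (\<lambda>(i, j). if j \<le> i then ?x ^ (i - j) else 0)"
  define E where "E = char_poly_matrix (companion_mat p)"
  have L: "L \<in> carrier_mat ?m ?m" by (simp add: L_def)
  have E: "E \<in> carrier_mat ?m ?m"
    unfolding E_def using companion_mat_carrier[of p] Suc by simp
  have EL: "E * L \<in> carrier_mat ?m ?m" using E L by simp
  have E_entry: "E $$ (i, j) = (if i = j then ?x else 0) -
      (if i = l then [:- coeff p j:] else if j = Suc i then 1 else 0)"
    if "i < ?m" "j < ?m" for i j
    using that Suc by (auto simp: E_def char_poly_matrix_def companion_mat_def one_pCons)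
  have EL_upper: "(E * L) $$ (i, j) = (if j = Suc i then - 1 else 0)" if i: "i < l" and j: "j < ?m" for i j
  proof -
    have "(E * L) $$ (i, j) = (\<Sum>k<?m. E $$ (i, k) * L $$ (k, j))"
      using E L i j by (auto simp: scalar_prod_def atLeast0LessThan)
    also have "\<dots> = (\<Sum>k<?m. (if k = i then ?x * L $$ (k, j) else 0) -
        (if k = Suc i then L $$ (k, j) else 0))"
      by (rule sum.cong) (use i in \<open>auto simp: E_entry\<close>)
    also have "\<dots> = ?x * L $$ (i, j) - L $$ (Suc i, j)"
      using i by (simp only: sum_subtractf sum.delta finite_lessThan) auto
    also have "\<dots> = (if j = Suc i then - 1 else 0)"
      using i j by (auto simp: L_def Suc_diff_le)
    finally show ?thesis .
  qed
  have EL_corner: "(E * L) $$ (l, 0) = p"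
  proof -
    have "(E * L) $$ (l, 0) = (\<Sum>k<?m. E $$ (l, k) * L $$ (k, 0))"
      using E L by (auto simp: scalar_prod_def atLeast0LessThan)
    also have "\<dots> = (\<Sum>k<?m. Polynomial.smult (coeff p k) (?x ^ k) + (if k = l then ?x * ?x ^ k else 0))"
      by (rule sum.cong) (auto simp: E_entry L_def algebra_simps)
    also have "\<dots> = (\<Sum>k<?m. Polynomial.smult (coeff p k) (?x ^ k)) + ?x ^ ?m"
      by (simp add: sum.distrib)
    also have "\<dots> = (\<Sum>k\<le>degree p. Polynomial.smult (coeff p k) (?x ^ k))"
      using monic Suc by (simp add: lessThan_Suc_atMost[symmetric])
    also have "\<dots> = p" using poly_eq_sum_X_powers[of p] by simp
    finally show ?thesis .
  qed
  have det_L: "det L = 1"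
  proof -
    have "det L = prod_list (diag_mat L)"
      by (rule det_lower_triangular[OF _ L]) (auto simp: L_def)
    also have "diag_mat L = map (\<lambda>i. 1) [0..<?m]"
      unfolding diag_mat_def using L by (intro map_cong) (auto simp: L_def)
    also have "prod_list \<dots> = (1 :: 'a poly)" by (simp add: map_replicate_const prod_list_replicate)
    finally show ?thesis .
  qed
  define D where "D = mat_delete (E * L) l 0"
  have D: "D \<in> carrier_mat l l" unfolding D_def using mat_delete_carrier[OF EL] by simp
  have D_entry: "D $$ (i, j) = (if i = j then - 1 else 0)" if "i < l" "j < l" for i j
    using that E L EL_upper[of i "Suc j"] by (auto simp: D_def mat_delete_def)
  have det_D: "det D = (- 1) ^ l"
  proof -
    have "det D = prod_list (diag_mat D)"
      by (rule det_lower_triangular[OF _ D]) (auto simp: D_entry)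
    also have "diag_mat D = map (\<lambda>i. - 1) [0..<l]"
      unfolding diag_mat_def using D by (intro map_cong) (auto simp: D_entry)
    also have "prod_list \<dots> = (- 1 :: 'a poly) ^ l" by (simp add: map_replicate_const prod_list_replicate)
    finally show ?thesis .
  qed
  have "det E = det (E * L)" using det_mult[OF E L] det_L by simp
  also have "\<dots> = (\<Sum>i<?m. (E * L) $$ (i, 0) * cofactor (E * L) i 0)"
    by (rule laplace_expansion_column[OF EL]) simp
  also have "\<dots> = (E * L) $$ (l, 0) * cofactor (E * L) l 0"
    by (simp add: EL_upper)
  also have "\<dots> = p" by (simp add: EL_corner cofactor_def flip: D_def power_mult_distrib)
    (simp add: det_D flip: power_mult_distrib)
  finally show ?thesis by (simp add: char_poly_def E_def)
qed

section \<open>Inverses of stacked matrices\<close>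

lemma inverse_mat:
  fixes M :: "'a::field mat"
  assumes M: "M \<in> carrier_mat n n" and det: "det M \<noteq> 0"
  shows "inverse_mat M \<in> carrier_mat n n" "M * inverse_mat M = 1\<^sub>m n" "inverse_mat M * M = 1\<^sub>m n"
proof -
  obtain N where "mat_inverse M = Some N"
    using mat_inverse(1)[OF M, of n] det_non_zero_imp_unit[OF M det, of n]
    by (cases "mat_inverse M") auto
  with mat_inverse(2)[OF M] show "inverse_mat M \<in> carrier_mat n n"
    "M * inverse_mat M = 1\<^sub>m n" "inverse_mat M * M = 1\<^sub>m n"
    by (auto simp: inverse_mat_def)
qed

lemma invertible_mat_iff_det:
  fixes M :: "'a::field mat"
  assumes M: "M \<in> carrier_mat n n"
  shows "invertible_mat M \<longleftrightarrow> det M \<noteq> 0"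
proof
  assume "invertible_mat M"
  then obtain N where N: "M * N = 1\<^sub>m (dim_row M)" "N * M = 1\<^sub>m (dim_row N)"
    by (auto simp: invertible_mat_def inverts_mat_def)
  then have "N \<in> carrier_mat n n"
    using M by (metis carrier_matD carrier_matI index_mult_mat(2,3) index_one_mat(2,3))
  with det_mult[OF M, of N] N(1) M show "det M \<noteq> 0" by auto
next
  assume "det M \<noteq> 0"
  from inverse_mat[OF M this] M show "invertible_mat M"
    unfolding invertible_mat_def inverts_mat_def square_mat.simps by auto
qed

text \<open>The column space is everything, because \<open>v = Q (N v)\<close> for every \<open>v\<close>.\<close>
lemma rank_of_right_invertible:
  fixes Q N :: "'a::field mat"
  assumes Q: "Q \<in> carrier_mat m n" and N: "N \<in> carrier_mat n m" and QN: "Q * N = 1\<^sub>m m"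
  shows "vec_space.rank m Q = m"
proof -
  interpret vec_space "TYPE('a)" m .
  have "span (set (cols Q)) = carrier_vec m"
    unfolding col_space_eq[OF Q, unfolded col_space_def]
  proof safe
    fix v :: "'a vec" assume v: "v \<in> carrier_vec m"
    have "Q *\<^sub>v (N *\<^sub>v v) = v"
      using assoc_mult_mat_vec[OF Q N v] QN v by simp
    then show "\<exists>x\<in>carrier_vec (dim_col Q). Q *\<^sub>v x = v"
      using Q N v by (intro bexI[of _ "N *\<^sub>v v"]) auto
  qed (use Q in auto)
  then have "span_vs (set (cols Q)) = V" by (simp add: module_vec_def)
  then show ?thesis unfolding rank_def using dim_is_n by simp
qed

lemma index_mult_mat_sum:
  assumes "M \<in> carrier_mat a b" "N \<in> carrier_mat b c" "i < a" "j < c"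
  shows "(M * N) $$ (i, j) = (\<Sum>l<b. M $$ (i, l) * N $$ (l, j))"
  using assms by (auto simp: scalar_prod_def atLeast0LessThan)

lemma four_block_mat_inject:
  assumes eq: "four_block_mat A B C D = four_block_mat A' B' C' D'"
    and "A \<in> carrier_mat a c" "B \<in> carrier_mat a d" "C \<in> carrier_mat b c" "D \<in> carrier_mat b d"
    and "A' \<in> carrier_mat a c" "B' \<in> carrier_mat a d" "C' \<in> carrier_mat b c" "D' \<in> carrier_mat b d"
  shows "A = A' \<and> B = B' \<and> C = C' \<and> D = D'"
proof -
  have entry: "four_block_mat A B C D $$ (i, j) = four_block_mat A' B' C' D' $$ (i, j)" for i j
    using eq by simp
  have "A $$ (i, j) = A' $$ (i, j)" if "i < a" "j < c" for i j
    using entry[of i j] that assms(2-) by simp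
  moreover have "B $$ (i, j) = B' $$ (i, j)" if "i < a" "j < d" for i j
    using entry[of i "c + j"] that assms(2-) by simp
  moreover have "C $$ (i, j) = C' $$ (i, j)" if "i < b" "j < c" for i j
    using entry[of "a + i" j] that assms(2-) by simp
  moreover have "D $$ (i, j) = D' $$ (i, j)" if "i < b" "j < d" for i j
    using entry[of "a + i" "c + j"] that assms(2-) by simp
  ultimately show ?thesis
    using assms(2-) by (intro conjI eq_matI) auto
qed

text \<open>The columns of the inverse of a stacked matrix split into \<open>N\<close>, a basis of the kernel of \<open>X\<close> dual to
  the rows of \<open>Q\<close>, and \<open>M\<close>, a basis of the kernel of \<open>Q\<close> dual to the rows of \<open>X\<close>. These block
  identities are all that is used about the inverse coordinate change.\<close>
lemma stacked_inverse_blocks: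
  fixes Q X :: "'a::field mat"
  assumes Q: "Q \<in> carrier_mat m n" and X: "X \<in> carrier_mat r n" and n: "m + r = n"
    and det: "det (Q @\<^sub>r X) \<noteq> 0"
  obtains N M where "N \<in> carrier_mat n m" "M \<in> carrier_mat n r"
    "inverse_mat (Q @\<^sub>r X) = four_block_mat N M (0\<^sub>m 0 m) (0\<^sub>m 0 r)"
    "Q * N = 1\<^sub>m m" "Q * M = 0\<^sub>m m r" "X * N = 0\<^sub>m r m" "X * M = 1\<^sub>m r"
    "N * Q + M * X = 1\<^sub>m n"
proof -
  define T where "T = Q @\<^sub>r X"
  define S where "S = inverse_mat T"
  have T: "T \<in> carrier_mat n n" using Q X n by (auto simp: T_def)
  have S: "S \<in> carrier_mat n n" and TS: "T * S = 1\<^sub>m n" and ST: "S * T = 1\<^sub>m n"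
    using inverse_mat[OF T] det by (auto simp: S_def T_def)
  define N where "N = mat n m (\<lambda>(i, j). S $$ (i, j))"
  define M where "M = mat n r (\<lambda>(i, j). S $$ (i, m + j))"
  have N: "N \<in> carrier_mat n m" and M: "M \<in> carrier_mat n r"
    by (simp_all add: N_def M_def)
  have S_blocks: "S = four_block_mat N M (0\<^sub>m 0 m) (0\<^sub>m 0 r)"
    using S n by (intro eq_matI) (auto simp: N_def M_def)
  have T_blocks: "T = four_block_mat Q (0\<^sub>m m 0) X (0\<^sub>m r 0)"
    using Q X by (simp add: T_def append_rows_def)
  have "four_block_mat (Q * N) (Q * M) (X * N) (X * M) = T * S"
    unfolding T_blocks S_blocks using Q X N M
    by (subst mult_four_block_mat[of _ m n _ 0 _ r _ _ m _ r]) auto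
  also have "\<dots> = four_block_mat (1\<^sub>m m) (0\<^sub>m m r) (0\<^sub>m r m) (1\<^sub>m r)"
    using TS n by simp
  finally have "Q * N = 1\<^sub>m m \<and> Q * M = 0\<^sub>m m r \<and> X * N = 0\<^sub>m r m \<and> X * M = 1\<^sub>m r"
    by (rule four_block_mat_inject) (use Q X N M in auto)
  moreover have "N * Q + M * X = 1\<^sub>m n"
  proof -
    have "S * T = four_block_mat (N * Q + M * X) (0\<^sub>m n 0) (0\<^sub>m 0 n) (0\<^sub>m 0 0)"
      unfolding T_blocks S_blocks using Q X N M
      by (subst mult_four_block_mat[of _ n m _ r _ 0 _ _ n _ 0]) auto
    also have "\<dots> = N * Q + M * X"
      using Q X N M by (intro eq_matI) auto
    finally show ?thesis using ST by simp
  qed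
  ultimately show thesis
    using N M S_blocks by (intro that) (simp_all add: S_def T_def)
qed

lemma index_mult_row_mat_sum:
  assumes "M \<in> carrier_mat 1 b" "N \<in> carrier_mat b c" "j < c"
  shows "(M * N) $$ (0, j) = (\<Sum>l<b. M $$ (0, l) * N $$ (l, j))"
  using index_mult_mat_sum[OF assms(1,2) _ assms(3), of 0] by simp

lemma index_row_mat_mult_vec:
  assumes "M \<in> carrier_mat 1 n" "w \<in> carrier_vec n"
  shows "(M *\<^sub>v w) $ 0 = (\<Sum>j<n. M $$ (0, j) * w $ j)"
  using assms by (auto simp: scalar_prod_def atLeast0LessThan)

section \<open>Similarity of the zero dynamics matrices\<close>

lemma output_derivative_rows_carrier:
  assumes "A \<in> carrier_mat n n"
  shows "output_derivative_rows A C r \<in> carrier_mat r n"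
  using assms by (simp add: output_derivative_rows_def)

lemma output_derivative_rows_mult:
  assumes A: "A \<in> carrier_mat n n" and C: "C \<in> carrier_mat 1 n" and Z: "Z \<in> carrier_mat n c"
    and i: "i < r" and j: "j < c"
  shows "(output_derivative_rows A C r * Z) $$ (i, j) = (C * A ^\<^sub>m i * Z) $$ (0, j)"
proof -
  have "(output_derivative_rows A C r * Z) $$ (i, j) =
      (\<Sum>l<n. output_derivative_rows A C r $$ (i, l) * Z $$ (l, j))"
    by (rule index_mult_mat_sum[OF output_derivative_rows_carrier[OF A] Z i j])
  also have "\<dots> = (\<Sum>l<n. (C * A ^\<^sub>m i) $$ (0, l) * Z $$ (l, j))"
    using A i by (simp add: output_derivative_rows_def)
  also have "\<dots> = (C * A ^\<^sub>m i * Z) $$ (0, j)"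
    by (rule index_mult_mat_sum[symmetric, of _ 1])
      (use A C Z j in \<open>auto intro!: mult_carrier_mat[of _ _ n]\<close>)
  finally show ?thesis .
qed

text \<open>Independence of the annihilator. With \<open>N\<close> and \<open>N'\<close> spanning the kernel of the output rows \<open>X\<close>, the
  zero dynamics matrices are \<open>Q A N\<close> and \<open>Q' A N'\<close>, and \<open>Q' N\<close> (with inverse \<open>Q N'\<close>) conjugates one
  into the other. Splitting \<open>A N' = N Q A N' + M X A N'\<close>, the second part must be invisible to \<open>Q'\<close>.
  It is: \<open>X A N'\<close> is zero except in its last row, since the other rows of \<open>X A\<close> are again rows of \<open>X\<close>;
  and the last column of \<open>Q' M\<close> is zero, since by the relative degree \<open>B\<close> is a nonzero multiple of the
  last column of \<open>M\<close> and \<open>Q' B = 0\<close>.\<close>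
lemma zero_dynamics_similar:
  fixes A B C Q N M Q' N' M' :: "real mat" and n r m :: nat
  defines "X \<equiv> output_derivative_rows A C r"
  assumes A: "A \<in> carrier_mat n n" and B: "B \<in> carrier_mat n 1" and C: "C \<in> carrier_mat 1 n"
    and rel: "relative_degree A B C r"
    and Q: "Q \<in> carrier_mat m n" and N: "N \<in> carrier_mat n m" and M: "M \<in> carrier_mat n r"
    and Q': "Q' \<in> carrier_mat m n" and N': "N' \<in> carrier_mat n m" and M': "M' \<in> carrier_mat n r"
    and QB: "Q * B = 0\<^sub>m m 1" and Q'B: "Q' * B = 0\<^sub>m m 1"
    and QN: "Q * N = 1\<^sub>m m" and Q'N': "Q' * N' = 1\<^sub>m m"
    and XN: "X * N = 0\<^sub>m r m" and XN': "X * N' = 0\<^sub>m r m"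
    and split: "N * Q + M * X = 1\<^sub>m n" and split': "N' * Q' + M' * X = 1\<^sub>m n"
  shows "similar_mat (Q' * A * N') (Q * A * N)"
proof -
  have X: "X \<in> carrier_mat r n"
    unfolding X_def by (rule output_derivative_rows_carrier[OF A])
  have r: "1 \<le> r" and C_last: "C * A ^\<^sub>m (r - 1) * B \<noteq> 0\<^sub>m 1 1"
    and C_low: "\<And>i. Suc i < r \<Longrightarrow> C * A ^\<^sub>m i * B = 0\<^sub>m 1 1"
    using rel unfolding relative_degree_def by (auto dest: spec[of _ "Suc _"])
  have decompose: "V = N * (Q * V) + M * (X * V)" if V: "V \<in> carrier_mat n c" for V c
  proof -
    have "V = (N * Q + M * X) * V" using split V by simp
    also have "\<dots> = N * Q * V + M * X * V"
      by (rule add_mult_distrib_mat[of _ n n]) (use N Q M X V in auto)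
    finally show ?thesis using N Q M X V by simp
  qed
  have decompose': "V = N' * (Q' * V) + M' * (X * V)" if V: "V \<in> carrier_mat n c" for V c
  proof -
    have "V = (N' * Q' + M' * X) * V" using split' V by simp
    also have "\<dots> = N' * Q' * V + M' * X * V"
      by (rule add_mult_distrib_mat[of _ n n]) (use N' Q' M' X V in auto)
    finally show ?thesis using N' Q' M' X V by simp
  qed
  have NQN': "N * (Q * N') = N'"
    using decompose[OF N'] XN' N Q N' M by simp
  have N'Q'N: "N' * (Q' * N) = N"
    using decompose'[OF N] XN N' Q' N M' by simp
  have Q'M: "Q' * M \<in> carrier_mat m r" using Q' M by simp
  have Q'M_last: "(Q' * M) $$ (i, r - 1) = 0" if i: "i < m" for i
  proof -
    have XB: "X * B \<in> carrier_mat r 1" using X B by simp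
    have "B = M * (X * B)"
      using decompose[OF B] QB N M XB by simp
    then have Q'B_eq: "Q' * B = Q' * M * (X * B)"
      using assoc_mult_mat[OF Q' M XB] by simp
    have "0 = (Q' * M * (X * B)) $$ (i, 0)"
      unfolding Q'B_eq[symmetric] Q'B using i by simp
    also have "\<dots> = (\<Sum>l<r. (Q' * M) $$ (i, l) * (X * B) $$ (l, 0))"
      by (rule index_mult_mat_sum[OF Q'M XB i]) simp
    also have "\<dots> = (\<Sum>l<r. if l = r - 1 then (Q' * M) $$ (i, l) * (C * A ^\<^sub>m l * B) $$ (0, 0) else 0)"
    proof (rule sum.cong[OF refl])
      fix l assume "l \<in> {..<r}"
      then show "(Q' * M) $$ (i, l) * (X * B) $$ (l, 0) =
          (if l = r - 1 then (Q' * M) $$ (i, l) * (C * A ^\<^sub>m l * B) $$ (0, 0) else 0)"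
        using output_derivative_rows_mult[OF A C B, of l r 0] C_low[of l] by (auto simp: X_def)
    qed
    also have "\<dots> = (Q' * M) $$ (i, r - 1) * (C * A ^\<^sub>m (r - 1) * B) $$ (0, 0)"
      using r by simp
    finally have "(Q' * M) $$ (i, r - 1) * (C * A ^\<^sub>m (r - 1) * B) $$ (0, 0) = 0" by simp
    moreover have "(C * A ^\<^sub>m (r - 1) * B) $$ (0, 0) \<noteq> 0"
    proof
      assume "(C * A ^\<^sub>m (r - 1) * B) $$ (0, 0) = 0"
      then have "C * A ^\<^sub>m (r - 1) * B = 0\<^sub>m 1 1"
        using B C by (intro eq_matI) auto
      with C_last show False by contradiction
    qed
    ultimately show ?thesis by simp
  qed
  have XAN': "(X * (A * N')) $$ (l, j) = 0" if "Suc l < r" "j < m" for l j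
  proof -
    have "(X * (A * N')) $$ (l, j) = (C * A ^\<^sub>m l * (A * N')) $$ (0, j)"
      unfolding X_def using A N' that
      by (intro output_derivative_rows_mult[OF A C]) auto
    also have "C * A ^\<^sub>m l * (A * N') = C * A ^\<^sub>m Suc l * N'"
    proof -
      have CA: "C * A ^\<^sub>m l \<in> carrier_mat 1 n" using C A by (auto intro: mult_carrier_mat)
      show ?thesis
        using assoc_mult_mat[OF CA A N'] assoc_mult_mat[OF C pow_carrier_mat[OF A] A] by simp
    qed
    also have "\<dots> $$ (0, j) = (X * N') $$ (Suc l, j)"
      unfolding X_def using that by (intro output_derivative_rows_mult[OF A C N', symmetric])
    finally show ?thesis using XN' that by simp
  qed
  have AN': "A * N' \<in> carrier_mat n m" using A N' by simp
  have XAN'_carrier: "X * (A * N') \<in> carrier_mat r m" using X AN' by simp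
  have cross: "Q' * M * (X * (A * N')) = 0\<^sub>m m m"
  proof (rule eq_matI)
    fix i j assume "i < dim_row (0\<^sub>m m m :: real mat)" "j < dim_col (0\<^sub>m m m :: real mat)"
    then have ij: "i < m" "j < m" by auto
    have "(Q' * M * (X * (A * N'))) $$ (i, j) =
        (\<Sum>l<r. (Q' * M) $$ (i, l) * (X * (A * N')) $$ (l, j))"
      by (rule index_mult_mat_sum[OF Q'M XAN'_carrier ij])
    also have "\<dots> = 0"
    proof (rule sum.neutral, rule ballI)
      fix l assume "l \<in> {..<r}"
      then show "(Q' * M) $$ (i, l) * (X * (A * N')) $$ (l, j) = 0"
        using Q'M_last[OF ij(1)] XAN'[of l j] ij by (cases "l = r - 1") auto
    qed
    finally show "(Q' * M * (X * (A * N'))) $$ (i, j) = 0\<^sub>m m m $$ (i, j)" using ij by simp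
  qed (use Q' AN' in auto)
  have QAN': "Q * (A * N') \<in> carrier_mat m m" using Q AN' by simp
  have "Q' * A * N' = Q' * (A * N')" using Q' A N' by simp
  also have "\<dots> = Q' * (N * (Q * (A * N')) + M * (X * (A * N')))"
    using decompose[OF AN'] by simp
  also have "\<dots> = Q' * (N * (Q * (A * N'))) + Q' * (M * (X * (A * N')))"
    by (rule mult_add_distrib_mat[OF Q']) (use N QAN' M XAN'_carrier in auto)
  also have "Q' * (M * (X * (A * N'))) = 0\<^sub>m m m"
    using cross assoc_mult_mat[OF Q' M XAN'_carrier] by simp
  also have "Q' * (N * (Q * (A * N'))) + 0\<^sub>m m m = Q' * (N * (Q * (A * N')))"
    using Q' N QAN' by (intro right_add_zero_mat) auto
  also have "A * N' = A * (N * (Q * N'))" using NQN' by simp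
  also have "Q' * (N * (Q * (A * (N * (Q * N'))))) = (Q' * N) * (Q * A * N) * (Q * N')"
  proof -
    have W: "Q * N' \<in> carrier_mat m m" and NW: "N * (Q * N') \<in> carrier_mat n m"
      and QA: "Q * A \<in> carrier_mat m n" and QAN: "Q * A * N \<in> carrier_mat m m"
      and Q'N: "Q' * N \<in> carrier_mat m m" and QANW: "Q * (A * (N * (Q * N'))) \<in> carrier_mat m m"
      using A Q Q' N N' by auto
    show ?thesis
      using assoc_mult_mat[OF Q'N QAN W] assoc_mult_mat[OF QA N W] assoc_mult_mat[OF Q A NW]
        assoc_mult_mat[OF Q' N QANW] by simp
  qed
  finally have conj: "Q' * A * N' = (Q' * N) * (Q * A * N) * (Q * N')" .
  have "Q' * N * (Q * N') = Q' * (N * (Q * N'))"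
    by (rule assoc_mult_mat[OF Q' N]) (use Q N' in auto)
  then have inv1: "Q' * N * (Q * N') = 1\<^sub>m m" using NQN' Q'N' by simp
  have "Q * N' * (Q' * N) = Q * (N' * (Q' * N))"
    by (rule assoc_mult_mat[OF Q N']) (use Q' N in auto)
  then have inv2: "Q * N' * (Q' * N) = 1\<^sub>m m" using N'Q'N QN by simp
  show ?thesis
    by (rule similar_matI[OF _ inv1 inv2 conj]) (use A Q N Q' N' in auto)
qed

text \<open>In terms of the blocks of the inverse coordinate change, \<open>A\<^sub>0 = Q A N\<close> and \<open>B\<^sub>0 = Q A M\<close>.\<close>
lemma admissible_annihilator_blocks:
  fixes A B C Q :: "real mat"
  assumes A: "A \<in> carrier_mat n n" and r: "r \<le> n"
    and adm: "admissible_annihilator A B C r Q"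
  obtains N M where "N \<in> carrier_mat n (n - r)" "M \<in> carrier_mat n r"
    "Q * N = 1\<^sub>m (n - r)"
    "output_derivative_rows A C r * N = 0\<^sub>m r (n - r)"
    "N * Q + M * output_derivative_rows A C r = 1\<^sub>m n"
    "Q * A * inverse_mat (normal_form_transformation A C r Q) =
      four_block_mat (Q * A * N) (Q * A * M) (0\<^sub>m 0 (n - r)) (0\<^sub>m 0 r)"
proof -
  let ?X = "output_derivative_rows A C r"
  have Q: "Q \<in> carrier_mat (n - r) n"
    and inv: "invertible_mat (normal_form_transformation A C r Q)"
    using adm A by (auto simp: admissible_annihilator_def Let_def)
  have X: "?X \<in> carrier_mat r n" by (rule output_derivative_rows_carrier[OF A])
  have nr: "n - r + r = n" using r by simp
  have "Q @\<^sub>r ?X \<in> carrier_mat (n - r + r) n" using Q X by (rule carrier_append_rows)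
  then have det: "det (Q @\<^sub>r ?X) \<noteq> 0"
    using inv nr invertible_mat_iff_det[of "Q @\<^sub>r ?X" n]
    by (simp add: normal_form_transformation_def)
  obtain N M where NM: "N \<in> carrier_mat n (n - r)" "M \<in> carrier_mat n r"
    and inv_blocks: "inverse_mat (Q @\<^sub>r ?X) = four_block_mat N M (0\<^sub>m 0 (n - r)) (0\<^sub>m 0 r)"
    and eqs: "Q * N = 1\<^sub>m (n - r)" "?X * N = 0\<^sub>m r (n - r)" "N * Q + M * ?X = 1\<^sub>m n"
    using stacked_inverse_blocks[OF Q X nr det] by metis
  have QA: "Q * A \<in> carrier_mat (n - r) n" using Q A by simp
  have "Q * A = four_block_mat (Q * A) (0\<^sub>m (n - r) 0) (0\<^sub>m 0 n) (0\<^sub>m 0 0)"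
    using QA by (intro eq_matI) auto
  then have "Q * A * four_block_mat N M (0\<^sub>m 0 (n - r)) (0\<^sub>m 0 r) =
      four_block_mat (Q * A) (0\<^sub>m (n - r) 0) (0\<^sub>m 0 n) (0\<^sub>m 0 0) *
      four_block_mat N M (0\<^sub>m 0 (n - r)) (0\<^sub>m 0 r)" by simp
  also have "\<dots> = four_block_mat (Q * A * N) (Q * A * M) (0\<^sub>m 0 (n - r)) (0\<^sub>m 0 r)"
    using QA NM by (subst mult_four_block_mat[of _ "n - r" n _ 0 _ 0 _ _ "n - r" _ r])
      (auto intro!: cong_four_block_mat right_add_zero_mat mult_carrier_mat[of _ _ n])
  finally show thesis
    using that[OF NM eqs] inv_blocks by (simp add: normal_form_transformation_def)
qed

section \<open>The flat output\<close>

locale cyclic_pair =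
  fixes n :: nat and A B :: "real mat"
  assumes n_pos: "1 \<le> n" and A: "A \<in> carrier_mat n n" and B: "B \<in> carrier_mat n 1"
    and nonsingular: "det (controllability_matrix A B) \<noteq> 0"
begin

text \<open>The row \<open>flat\<close> is the last row of the inverse controllability matrix: the output of relative degree
  \<open>n\<close> (flat output) normalized by \<open>flat A\<^sup>n\<^sup>-\<^sup>1 B = 1\<close>.\<close>
definition flat :: "real mat" where
  "flat = last_unit_row n * inverse_mat (controllability_matrix A B)"

text \<open>For \<open>k < n\<close>, this row gives the \<open>k\<close>-th time derivative of the flat output along trajectories.\<close>
definition dflat :: "nat \<Rightarrow> real mat" where "dflat k = flat * A ^\<^sub>m k"

lemma ctrb_carrier: "controllability_matrix A B \<in> carrier_mat n n"
  using A by (simp add: controllability_matrix_def)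

lemmas ctrb_inverse = inverse_mat[OF ctrb_carrier nonsingular]

lemma flat_carrier: "flat \<in> carrier_mat 1 n"
  using ctrb_inverse(1) by (auto simp: flat_def last_unit_row_def)

lemma dflat_carrier: "dflat k \<in> carrier_mat 1 n"
  using flat_carrier A by (auto simp: dflat_def intro: mult_carrier_mat)

lemma dflat_Suc: "dflat (Suc k) = dflat k * A"
  using assoc_mult_mat[OF flat_carrier pow_carrier_mat[OF A] A] by (simp add: dflat_def)

lemma dflat_0: "dflat 0 = flat"
  using flat_carrier A by (simp add: dflat_def)

lemma dflat_controllability_matrix:
  "j < n \<Longrightarrow> (dflat k * controllability_matrix A B) $$ (0, j) = (dflat (k + j) * B) $$ (0, 0)"
proof -
  assume j: "j < n"
  have AjB: "A ^\<^sub>m j * B \<in> carrier_mat n 1" using A B by (auto intro: mult_carrier_mat)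
  have "dflat k * (A ^\<^sub>m j * B) = dflat (k + j) * B"
  proof -
    have "dflat k * A ^\<^sub>m j = dflat (k + j)"
    proof (induction j)
      case 0
      then show ?case using dflat_carrier[of k] A by simp
    next
      case (Suc j)
      then show ?case
        using assoc_mult_mat[OF dflat_carrier pow_carrier_mat[OF A] A, of k j] by (simp add: dflat_Suc)
    qed
    then show ?thesis
      using assoc_mult_mat[OF dflat_carrier pow_carrier_mat[OF A] B, of k j] by simp
  qed
  moreover have "(dflat k * controllability_matrix A B) $$ (0, j) = (dflat k * (A ^\<^sub>m j * B)) $$ (0, 0)"
    unfolding index_mult_row_mat_sum[OF dflat_carrier ctrb_carrier j]
      index_mult_row_mat_sum[OF dflat_carrier AjB less_one[THEN iffD2, OF refl]]
    using A j by (intro sum.cong) (auto simp: controllability_matrix_def)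
  ultimately show ?thesis by simp
qed

lemma dflat_input: "k < n \<Longrightarrow> (dflat k * B) $$ (0, 0) = (if Suc k = n then 1 else 0)"
proof -
  assume k: "k < n"
  have l: "last_unit_row n \<in> carrier_mat 1 n" by (simp add: last_unit_row_def)
  have "flat * controllability_matrix A B = last_unit_row n"
    unfolding flat_def using assoc_mult_mat[OF l ctrb_inverse(1) ctrb_carrier] ctrb_inverse(3)
      right_mult_one_mat[OF l] by simp
  then have "(dflat k * B) $$ (0, 0) = last_unit_row n $$ (0, k)"
    using dflat_controllability_matrix[OF k, of 0] by (simp add: dflat_0 del: index_mult_mat(1))
  moreover have "k = n - 1 \<longleftrightarrow> Suc k = n" using k by auto
  ultimately show ?thesis using k by (simp add: last_unit_row_def)
qed

text \<open>The rows \<open>dflat 0, \<dots>, dflat (n - 1)\<close> are coordinates on the state space. Multiplied by the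
  controllability matrix they form a Hankel matrix with zeros above the antidiagonal and ones on it,
  so the coordinates of \<open>v\<close> in the basis \<open>B, A B, \<dots>\<close> vanish one after the other, starting from the
  last one.\<close>
lemma dflat_separates:
  assumes v: "v \<in> carrier_vec n" and zero: "\<And>k. k < n \<Longrightarrow> (\<Sum>l<n. dflat k $$ (0, l) * v $ l) = 0"
  shows "v = 0\<^sub>v n"
proof -
  define w where "w = inverse_mat (controllability_matrix A B) *\<^sub>v v"
  have w: "w \<in> carrier_vec n" using ctrb_inverse(1) v by (simp add: w_def)
  have v_eq: "v = controllability_matrix A B *\<^sub>v w"
    unfolding w_def using assoc_mult_mat_vec[OF ctrb_carrier ctrb_inverse(1) v] ctrb_inverse(2) v by simp
  have conv: "(\<Sum>j<n. (dflat (k + j) * B) $$ (0, 0) * w $ j) = 0" if k: "k < n" for k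
  proof -
    have "((dflat k * controllability_matrix A B) *\<^sub>v w) $ 0 =
        (\<Sum>j<n. (dflat k * controllability_matrix A B) $$ (0, j) * w $ j)"
      by (rule index_row_mat_mult_vec[OF mult_carrier_mat[OF dflat_carrier ctrb_carrier] w])
    then have "(\<Sum>j<n. (dflat (k + j) * B) $$ (0, 0) * w $ j) =
        ((dflat k * controllability_matrix A B) *\<^sub>v w) $ 0"
      by (simp add: dflat_controllability_matrix del: index_mult_mat(1))
    also have "(dflat k * controllability_matrix A B) *\<^sub>v w = dflat k *\<^sub>v v"
      unfolding v_eq by (rule assoc_mult_mat_vec[OF dflat_carrier ctrb_carrier w])
    also have "\<dots> $ 0 = (\<Sum>l<n. dflat k $$ (0, l) * v $ l)"
      by (rule index_row_mat_mult_vec[OF dflat_carrier v])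
    finally show ?thesis using zero[OF k] by simp
  qed
  have w_zero: "w $ (n - Suc k) = 0" if "k < n" for k
    using that
  proof (induction k rule: less_induct)
    case (less k)
    have "0 = (\<Sum>j<n. (dflat (k + j) * B) $$ (0, 0) * w $ j)" using conv[OF less.prems] by simp
    also have "\<dots> = (\<Sum>j<n. if j = n - Suc k then w $ j else 0)"
    proof (rule sum.cong[OF refl])
      fix j assume "j \<in> {..<n}"
      then consider "k + j < n" | "n - Suc j < k" "j < n" by fastforce
      then show "(dflat (k + j) * B) $$ (0, 0) * w $ j = (if j = n - Suc k then w $ j else 0)"
      proof cases
        case 1
        then show ?thesis using dflat_input[of "k + j"] less.prems by auto
      next
        case 2
        then have "w $ (n - Suc (n - Suc j)) = 0" using less.prems by (intro less.IH) auto
        moreover have "n - Suc (n - Suc j) = j" "j \<noteq> n - Suc k" using 2 less.prems by auto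
        ultimately show ?thesis by simp
      qed
    qed
    also have "\<dots> = w $ (n - Suc k)" using less.prems by simp
    finally show ?case by simp
  qed
  have "w = 0\<^sub>v n"
  proof (rule eq_vecI)
    fix i assume "i < dim_vec (0\<^sub>v n :: real vec)"
    with w_zero[of "n - Suc i"] show "w $ i = 0\<^sub>v n $ i" by simp
  qed (use w in simp)
  with v_eq ctrb_carrier show ?thesis by (auto intro!: eq_vecI)
qed

end

section \<open>The designed output and its zero dynamics\<close>

text \<open>The output designed from \<open>\<gamma>\<close>: on trajectories it is \<open>\<sigma> = \<gamma>(d/dt) y\<close> for the flat output \<open>y\<close>.\<close>
locale designed_output = cyclic_pair +
  fixes r :: nat and \<gamma> :: "real poly" and C :: "real mat"
  assumes r_pos: "1 \<le> r" and r_le: "r \<le> n"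
    and deg: "degree \<gamma> = n - r" and monic: "lead_coeff \<gamma> = 1"
    and C_def: "C = flat * poly_mat \<gamma> A"
begin

lemma C_carrier: "C \<in> carrier_mat 1 n"
  using flat_carrier A by (auto simp: C_def poly_mat_def)

lemma combination_mult:
  assumes R: "R \<in> carrier_mat 1 n" and X: "X \<in> carrier_mat n c" and j: "j < c"
    and comb: "\<And>l. l < n \<Longrightarrow> R $$ (0, l) = (\<Sum>k\<le>n - r. coeff \<gamma> k * dflat (k + i) $$ (0, l))"
  shows "(R * X) $$ (0, j) = (\<Sum>k\<le>n - r. coeff \<gamma> k * (dflat (k + i) * X) $$ (0, j))"
proof -
  have "(R * X) $$ (0, j) = (\<Sum>l<n. \<Sum>k\<le>n - r. coeff \<gamma> k * (dflat (k + i) $$ (0, l) * X $$ (l, j)))"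
    unfolding index_mult_row_mat_sum[OF R X j]
    by (simp add: comb sum_distrib_right mult.assoc)
  also have "\<dots> = (\<Sum>k\<le>n - r. coeff \<gamma> k * (dflat (k + i) * X) $$ (0, j))"
    unfolding index_mult_row_mat_sum[OF dflat_carrier X j] sum_distrib_left
    by (rule sum.swap)
  finally show ?thesis .
qed

lemma CA_carrier: "C * A ^\<^sub>m i \<in> carrier_mat 1 n"
  using C_carrier A by (auto intro: mult_carrier_mat)

lemma CA_entry:
  "j < n \<Longrightarrow> (C * A ^\<^sub>m i) $$ (0, j) = (\<Sum>k\<le>n - r. coeff \<gamma> k * dflat (k + i) $$ (0, j))"
proof (induction i arbitrary: j)
  case 0
  have p: "poly_mat \<gamma> A \<in> carrier_mat n n" using A by (simp add: poly_mat_def)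
  have "(C * A ^\<^sub>m 0) $$ (0, j) = (flat * poly_mat \<gamma> A) $$ (0, j)"
    using A right_mult_one_mat[OF C_carrier] by (simp add: C_def)
  also have "\<dots> = (\<Sum>l<n. \<Sum>k\<le>n - r. coeff \<gamma> k * (flat $$ (0, l) * (A ^\<^sub>m k) $$ (l, j)))"
    unfolding index_mult_row_mat_sum[OF flat_carrier p 0]
    using A 0 by (intro sum.cong) (auto simp: poly_mat_def deg sum_distrib_left algebra_simps)
  also have "\<dots> = (\<Sum>k\<le>n - r. coeff \<gamma> k * dflat k $$ (0, j))"
    unfolding dflat_def index_mult_row_mat_sum[OF flat_carrier pow_carrier_mat[OF A] 0] sum_distrib_left
    by (rule sum.swap)
  finally show ?case by simp
next
  case (Suc i)
  have "C * A ^\<^sub>m Suc i = C * A ^\<^sub>m i * A"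
    using assoc_mult_mat[OF C_carrier pow_carrier_mat[OF A] A] by simp
  then show ?case
    using combination_mult[OF CA_carrier A Suc.prems Suc.IH] by (simp add: dflat_Suc)
qed

text \<open>Only the leading term of \<open>\<gamma>\<close> can lift the order of differentiation of the flat output to
  \<open>n - 1\<close>, where the input enters, and it does so precisely for \<open>i = r - 1\<close>.\<close>
lemma CAB_entry: "i < r \<Longrightarrow> (C * A ^\<^sub>m i * B) $$ (0, 0) = (if Suc i = r then 1 else 0)"
proof -
  assume i: "i < r"
  have "(C * A ^\<^sub>m i * B) $$ (0, 0) = (\<Sum>k\<le>n - r. coeff \<gamma> k * (dflat (k + i) * B) $$ (0, 0))"
    by (rule combination_mult[OF CA_carrier B less_one[THEN iffD2, OF refl] CA_entry])
  also have "\<dots> = (\<Sum>k\<le>n - r. if k = n - r then (if Suc i = r then 1 else 0) else 0)"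
  proof (rule sum.cong[OF refl])
    fix k assume "k \<in> {..n - r}"
    then show "coeff \<gamma> k * (dflat (k + i) * B) $$ (0, 0) =
        (if k = n - r then (if Suc i = r then 1 else 0) else 0)"
      using dflat_input[of "k + i"] i r_le monic deg by auto
  qed
  also have "\<dots> = (if Suc i = r then 1 else 0)" by simp
  finally show ?thesis .
qed

lemma relative_degree_r: "relative_degree A B C r"
proof -
  have "C * A ^\<^sub>m (i - 1) * B = 0\<^sub>m 1 1" if "1 \<le> i" "i < r" for i
    using that CAB_entry[of "i - 1"] CA_carrier[of "i - 1"] B C_carrier by (intro eq_matI) auto
  moreover have "C * A ^\<^sub>m (r - 1) * B \<noteq> 0\<^sub>m 1 1"
  proof
    assume "C * A ^\<^sub>m (r - 1) * B = 0\<^sub>m 1 1"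
    with CAB_entry[of "r - 1"] r_pos show False by simp
  qed
  ultimately show ?thesis using r_pos by (simp add: relative_degree_def)
qed

text \<open>A canonical choice of the annihilator \<open>B\<^sup>\<bottom>\<close>, with \<open>\<eta> = (y, y', \<dots>, y\<^sup>(\<^sup>n\<^sup>-\<^sup>r\<^sup>-\<^sup>1\<^sup>))\<close> for the flat output
  \<open>y\<close>. In these coordinates the zero dynamics are visibly \<open>\<gamma>(d/dt) y = 0\<close>.\<close>
definition dflat_rows :: "real mat" where
  "dflat_rows = mat (n - r) n (\<lambda>(i, j). dflat i $$ (0, j))"

lemma dflat_rows_carrier: "dflat_rows \<in> carrier_mat (n - r) n"
  by (simp add: dflat_rows_def)

lemma dflat_rows_mult:
  assumes Z: "Z \<in> carrier_mat n c" and "i < n - r" "j < c"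
  shows "(dflat_rows * Z) $$ (i, j) = (dflat i * Z) $$ (0, j)"
  unfolding index_mult_mat_sum[OF dflat_rows_carrier Z assms(2,3)]
    index_mult_row_mat_sum[OF dflat_carrier Z assms(3)]
  using assms by (simp add: dflat_rows_def)

lemma dflat_rows_B: "dflat_rows * B = 0\<^sub>m (n - r) 1"
  using dflat_rows_mult[OF B, of _ 0] dflat_input dflat_rows_carrier B r_pos by (intro eq_matI) auto

text \<open>As \<open>\<gamma>\<close> is monic, the row \<open>C A\<^sup>i\<close> is \<open>dflat (n - r + i)\<close> plus a combination of earlier rows. Hence a
  vector killed by all the stacked rows is killed successively by \<open>dflat 0, \<dots>, dflat (n - 1)\<close>.\<close>
lemma transformation_nonsingular: "det (dflat_rows @\<^sub>r output_derivative_rows A C r) \<noteq> 0"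
proof
  let ?X = "output_derivative_rows A C r"
  have X: "?X \<in> carrier_mat r n" by (rule output_derivative_rows_carrier[OF A])
  have T: "dflat_rows @\<^sub>r ?X \<in> carrier_mat n n"
    using carrier_append_rows[OF dflat_rows_carrier X] r_le by simp
  assume "det (dflat_rows @\<^sub>r ?X) = 0"
  then obtain v where v: "v \<in> carrier_vec n" "v \<noteq> 0\<^sub>v n" and Tv: "(dflat_rows @\<^sub>r ?X) *\<^sub>v v = 0\<^sub>v n"
    using det_0_iff_vec_prod_zero_field[OF T] by auto
  have "(dflat_rows *\<^sub>v v) @\<^sub>v (?X *\<^sub>v v) = 0\<^sub>v (n - r) @\<^sub>v 0\<^sub>v r"
    using Tv mat_mult_append[OF dflat_rows_carrier X v(1)] r_le by (auto intro!: eq_vecI)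
  then have Qv: "dflat_rows *\<^sub>v v = 0\<^sub>v (n - r)" and Xv: "?X *\<^sub>v v = 0\<^sub>v r"
    using append_vec_eq[of "dflat_rows *\<^sub>v v" "n - r" "0\<^sub>v (n - r)"] dflat_rows_carrier v(1) by auto
  define \<sigma> where "\<sigma> k = (\<Sum>l<n. dflat k $$ (0, l) * v $ l)" for k
  have low: "\<sigma> k = 0" if "k < n - r" for k
  proof -
    have "\<sigma> k = (dflat_rows *\<^sub>v v) $ k"
      using that v(1) by (auto simp: \<sigma>_def dflat_rows_def scalar_prod_def atLeast0LessThan)
    with Qv that show ?thesis by simp
  qed
  have high: "(\<Sum>k\<le>n - r. coeff \<gamma> k * \<sigma> (k + i)) = 0" if "i < r" for i
  proof -
    have "(\<Sum>k\<le>n - r. coeff \<gamma> k * \<sigma> (k + i)) =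
        (\<Sum>l<n. (\<Sum>k\<le>n - r. coeff \<gamma> k * dflat (k + i) $$ (0, l)) * v $ l)"
      unfolding \<sigma>_def sum_distrib_left sum_distrib_right mult.assoc by (rule sum.swap)
    also have "\<dots> = (?X *\<^sub>v v) $ i"
      using that v(1) A
      by (auto simp: output_derivative_rows_def CA_entry scalar_prod_def atLeast0LessThan
          simp del: index_mult_mat(1))
    finally show ?thesis using Xv that by simp
  qed
  have "\<sigma> k = 0" if "k < n" for k
    using that
  proof (induction k rule: less_induct)
    case (less k)
    show ?case
    proof (cases "k < n - r")
      case False
      have "0 = (\<Sum>l\<le>n - r. coeff \<gamma> l * \<sigma> (l + (k - (n - r))))"
        using high[of "k - (n - r)"] less.prems False by simp
      also have "\<dots> = (\<Sum>l\<le>n - r. if l = n - r then \<sigma> k else 0)"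
        by (rule sum.cong) (use less False monic deg in auto)
      finally show ?thesis by simp
    qed (rule low)
  qed
  with dflat_separates[OF v(1)] v(2) show False by (simp add: \<sigma>_def)
qed

lemma dflat_rows_admissible: "admissible_annihilator A B C r dflat_rows"
proof -
  let ?X = "output_derivative_rows A C r"
  have X: "?X \<in> carrier_mat r n" by (rule output_derivative_rows_carrier[OF A])
  have nr: "n - r + r = n" using r_le by simp
  obtain N where N: "N \<in> carrier_mat n (n - r)" "dflat_rows * N = 1\<^sub>m (n - r)"
    using stacked_inverse_blocks[OF dflat_rows_carrier X nr transformation_nonsingular] by metis
  have "dflat_rows @\<^sub>r ?X \<in> carrier_mat n n" using carrier_append_rows[OF dflat_rows_carrier X] nr by simp
  then have "invertible_mat (dflat_rows @\<^sub>r ?X)"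
    using invertible_mat_iff_det transformation_nonsingular by blast
  then show ?thesis
    using A dflat_rows_carrier dflat_rows_B rank_of_right_invertible[OF dflat_rows_carrier N]
    by (simp add: admissible_annihilator_def normal_form_transformation_def)
qed

text \<open>Multiplication by \<open>A\<close> shifts \<open>dflat i\<close> to \<open>dflat (i + 1)\<close>. The shift out of the last row is
  \<open>dflat (n - r) = C - \<Sum>k<n - r. \<gamma>\<^sub>k dflat k\<close>, and \<open>C\<close> vanishes on the columns of \<open>N\<close>.\<close>
lemma dflat_rows_zero_dynamics:
  assumes N: "N \<in> carrier_mat n (n - r)" and QN: "dflat_rows * N = 1\<^sub>m (n - r)"
    and XN: "output_derivative_rows A C r * N = 0\<^sub>m r (n - r)"
  shows "dflat_rows * A * N = companion_mat \<gamma>"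
proof (rule eq_matI)
  fix i j assume "i < dim_row (companion_mat \<gamma>)" "j < dim_col (companion_mat \<gamma>)"
  then have ij: "i < n - r" "j < n - r" by (simp_all add: companion_mat_def deg)
  have sN: "(dflat k * N) $$ (0, j) = (if k = j then 1 else 0)" if "k < n - r" for k
    using dflat_rows_mult[OF N that ij(2)] QN that ij by simp
  have AN: "A * N \<in> carrier_mat n (n - r)" using A N by simp
  have "(dflat_rows * A * N) $$ (i, j) = (dflat_rows * (A * N)) $$ (i, j)" using dflat_rows_carrier A N by simp
  also have "\<dots> = (dflat i * (A * N)) $$ (0, j)" by (rule dflat_rows_mult[OF AN ij])
  also have "dflat i * (A * N) = dflat (Suc i) * N"
    using assoc_mult_mat[OF dflat_carrier A N] by (simp add: dflat_Suc)
  also have "(dflat (Suc i) * N) $$ (0, j) = companion_mat \<gamma> $$ (i, j)"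
  proof (cases "Suc i = n - r")
    case False
    then show ?thesis using sN[of "Suc i"] ij by (auto simp: companion_mat_def deg)
  next
    case True
    have "0 = (C * A ^\<^sub>m 0 * N) $$ (0, j)"
      using output_derivative_rows_mult[OF A C_carrier N, of 0 r j] XN r_pos ij by simp
    also have "\<dots> = (\<Sum>k\<le>n - r. coeff \<gamma> k * (dflat (k + 0) * N) $$ (0, j))"
      by (rule combination_mult[OF CA_carrier N ij(2) CA_entry])
    also have "\<dots> = (\<Sum>k\<le>i. coeff \<gamma> k * (dflat k * N) $$ (0, j)) + (dflat (Suc i) * N) $$ (0, j)"
      using monic deg by (simp flip: True)
    also have "(\<Sum>k\<le>i. coeff \<gamma> k * (dflat k * N) $$ (0, j)) = (\<Sum>k\<le>i. if k = j then coeff \<gamma> k else 0)"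
      using sN True by (intro sum.cong) auto
    also have "\<dots> = coeff \<gamma> j" using ij True by simp
    finally show ?thesis using True ij by (simp add: companion_mat_def deg)
  qed
  finally show "(dflat_rows * A * N) $$ (i, j) = companion_mat \<gamma> $$ (i, j)" .
qed (use dflat_rows_carrier A N in \<open>simp_all add: companion_mat_def deg\<close>)

lemma zero_dynamics_matrix_companion: "zero_dynamics_matrix A B C r (companion_mat \<gamma>)"
proof -
  obtain N M where N: "N \<in> carrier_mat n (n - r)" and M: "M \<in> carrier_mat n r"
    and QN: "dflat_rows * N = 1\<^sub>m (n - r)" and XN: "output_derivative_rows A C r * N = 0\<^sub>m r (n - r)"
    and blocks: "dflat_rows * A * inverse_mat (normal_form_transformation A C r dflat_rows) =
      four_block_mat (dflat_rows * A * N) (dflat_rows * A * M) (0\<^sub>m 0 (n - r)) (0\<^sub>m 0 r)"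
    using admissible_annihilator_blocks[OF A r_le dflat_rows_admissible] by metis
  have "companion_mat \<gamma> \<in> carrier_mat (n - r) (n - r)"
    using companion_mat_carrier[of \<gamma>] deg by simp
  moreover have "dflat_rows * A * M \<in> carrier_mat (n - r) r" using dflat_rows_carrier A M by simp
  ultimately show ?thesis
    using dflat_rows_admissible blocks dflat_rows_zero_dynamics[OF N QN XN] A
    unfolding zero_dynamics_matrix_def Let_def by (metis carrier_matD(1))
qed

lemma zero_dynamics_char_poly:
  assumes "zero_dynamics_matrix A B C r A0"
  shows "char_poly A0 = \<gamma>"
proof -
  obtain Q' B0 where A0: "A0 \<in> carrier_mat (n - r) (n - r)" and B0: "B0 \<in> carrier_mat (n - r) r"
    and adm: "admissible_annihilator A B C r Q'"
    and A0_eq: "four_block_mat A0 B0 (0\<^sub>m 0 (n - r)) (0\<^sub>m 0 r) =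
      Q' * A * inverse_mat (normal_form_transformation A C r Q')"
    using assms A unfolding zero_dynamics_matrix_def Let_def by auto
  have Q': "Q' \<in> carrier_mat (n - r) n" and Q'B: "Q' * B = 0\<^sub>m (n - r) 1"
    using adm A by (auto simp: admissible_annihilator_def Let_def)
  obtain N' M' where N': "N' \<in> carrier_mat n (n - r)" and M': "M' \<in> carrier_mat n r"
    and eqs': "Q' * N' = 1\<^sub>m (n - r)" "output_derivative_rows A C r * N' = 0\<^sub>m r (n - r)"
      "N' * Q' + M' * output_derivative_rows A C r = 1\<^sub>m n"
    and blocks: "Q' * A * inverse_mat (normal_form_transformation A C r Q') =
      four_block_mat (Q' * A * N') (Q' * A * M') (0\<^sub>m 0 (n - r)) (0\<^sub>m 0 r)"
    using admissible_annihilator_blocks[OF A r_le adm] by metis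
  have "A0 = Q' * A * N' \<and> B0 = Q' * A * M' \<and>
      (0\<^sub>m 0 (n - r) :: real mat) = 0\<^sub>m 0 (n - r) \<and> (0\<^sub>m 0 r :: real mat) = 0\<^sub>m 0 r"
    by (rule four_block_mat_inject[OF A0_eq[unfolded blocks] A0 B0])
      (use Q' A N' M' in auto)
  then have A0_N': "A0 = Q' * A * N'" by simp
  obtain N M where N: "N \<in> carrier_mat n (n - r)" and M: "M \<in> carrier_mat n r"
    and eqs: "dflat_rows * N = 1\<^sub>m (n - r)" "output_derivative_rows A C r * N = 0\<^sub>m r (n - r)"
      "N * dflat_rows + M * output_derivative_rows A C r = 1\<^sub>m n"
    using admissible_annihilator_blocks[OF A r_le dflat_rows_admissible] by metis
  have "similar_mat A0 (companion_mat \<gamma>)"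
    using zero_dynamics_similar[OF A B C_carrier relative_degree_r dflat_rows_carrier N M Q' N' M' dflat_rows_B Q'B
        eqs(1) eqs'(1) eqs(2) eqs'(2) eqs(3) eqs'(3)]
    unfolding A0_N' dflat_rows_zero_dynamics[OF N eqs(1,2)] .
  then show ?thesis
    using char_poly_similar char_poly_companion_mat[OF monic] by metis
qed

end

section \<open>Relative degree and eigenvalues of the sliding mode\<close>

theorem theorem3:
  fixes A B C :: "real mat" and \<gamma> :: "real poly" and n r :: nat
  assumes "1 \<le> n"
    and "A \<in> carrier_mat n n" and "B \<in> carrier_mat n 1"
    and "controllable A B"
    and "1 \<le> r" and "r \<le> n"
    and "degree \<gamma> = n - r" and "lead_coeff \<gamma> = 1"
    and "C = last_unit_row n * inverse_mat (controllability_matrix A B) * poly_mat \<gamma> A"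
  shows "relative_degree A B C r \<and>
    (\<exists>A0. zero_dynamics_matrix A B C r A0) \<and>
    (\<forall>A0. zero_dynamics_matrix A B C r A0 \<longrightarrow>
       eigenvalue_mset A0 = proots (map_poly complex_of_real \<gamma>))"
proof -
  interpret cyclic_pair n A B
    using assms(1-4) controllable_imp_controllability_matrix_nonsingular by unfold_locales auto
  interpret designed_output n A B r \<gamma> C
    using assms(5-9) by unfold_locales (auto simp: flat_def)
  have "eigenvalue_mset A0 = proots (map_poly complex_of_real \<gamma>)"
    if zd: "zero_dynamics_matrix A B C r A0" for A0
  proof -
    have "A0 \<in> carrier_mat (n - r) (n - r)"
      using zd assms(2) by (auto simp: zero_dynamics_matrix_def Let_def)
    then show ?thesis
      unfolding eigenvalue_mset_def
      by (simp add: of_real_hom.char_poly_hom zero_dynamics_char_poly[OF zd])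
  qed
  then show ?thesis
    using relative_degree_r zero_dynamics_matrix_companion by blast
qed

end
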